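(* Let $X$ be a metrizable (real) locally convex space. Then each bounded sequence in $X$ contains either a weakly Cauchy subsequence or a subsequence which is an $\ell_1$-sequence.
   Context: Vector spaces are real. A sequence $(x_n)$ in $X$ is weakly Cauchy if $(x^*(x_n))_n$ is a Cauchy sequence of reals for each continuous linear functional $x^*\in X^*$. Let $\ell_1^0$ be the subspace of $\ell_1$ formed by elements with only finitely many nonzero coordinates, equipped with the $\ell_1$-norm. A sequence $(x_n)$ in a topological vector space $X$ is an $\ell_1$-sequence if the linear mapping $T_0\colon\ell_1^0\to X$, $T_0((a_i)_{i=1}^\infty)=\sum_{i=1}^\infty a_ix_i$, is an isomorphism (linear homeomorphism) of $\ell_1^0$ onto $T_0(\ell_1^0)$. *)

theory Defs
  imports "HOL-Analysis.Analysis" "HOL-Analysis.Finite_Function_Topology"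
begin

class real_tvs = real_vector + topological_ab_group_add +
  assumes tendsto_scaleR_Pair:
    "LIM p (nhds c \<times>\<^sub>F nhds v). fst p *\<^sub>R snd p :> nhds (c *\<^sub>R v)"

(* The third conjunct is convex V with its library definition unfolded: that constant cannot be
   applied to the type of a class inside the specification of the class (see locally_convex below). *)
class real_lcs = real_tvs +
  assumes locally_convex_raw: "open U \<Longrightarrow> 0 \<in> U \<Longrightarrow>
    \<exists>V. open V \<and> 0 \<in> V \<and>
      (\<forall>x\<in>V. \<forall>y\<in>V. \<forall>u\<ge>0. \<forall>v\<ge>0. u + v = 1 \<longrightarrow> u *\<^sub>R x + v *\<^sub>R y \<in> V) \<and>
      V \<subseteq> U"

lemma locally_convex:
  fixes U :: "'a::real_lcs set"
  assumes "open U" "0 \<in> U"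
  shows "\<exists>V. open V \<and> 0 \<in> V \<and> convex V \<and> V \<subseteq> U"
  using locally_convex_raw[OF assms] by (simp add: convex_def)

instance real_normed_vector \<subseteq> real_lcs
proof
  show "LIM p (nhds c \<times>\<^sub>F nhds v). fst p *\<^sub>R snd p :> nhds (c *\<^sub>R v)" for c and v :: 'a
    by (intro tendsto_scaleR filterlim_fst filterlim_snd)
  show "\<exists>V. open V \<and> 0 \<in> V \<and>
      (\<forall>x\<in>V. \<forall>y\<in>V. \<forall>u\<ge>0. \<forall>v\<ge>0. u + v = 1 \<longrightarrow> u *\<^sub>R x + v *\<^sub>R y \<in> V) \<and>
      V \<subseteq> U" if "open U" "0 \<in> U" for U :: "'a set"
    unfolding convex_def[symmetric]
    using that by (metis centre_in_ball convex_ball open_ball open_contains_ball)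
qed

(* Boundedness in the sense of topological vector spaces (absorbed by every
   neighbourhood of 0).  This is not boundedness for a compatible metric. *)
definition tvs_bounded :: "'a::real_tvs set \<Rightarrow> bool" where
  "tvs_bounded S \<longleftrightarrow>
     (\<forall>U. open U \<and> 0 \<in> U \<longrightarrow> (\<exists>s>0. \<forall>t>s. S \<subseteq> (\<lambda>u. t *\<^sub>R u) ` U))"

definition weakly_Cauchy :: "(nat \<Rightarrow> 'a::real_tvs) \<Rightarrow> bool" where
  "weakly_Cauchy x \<longleftrightarrow>
     (\<forall>f::'a \<Rightarrow> real. linear f \<and> continuous_on UNIV f \<longrightarrow> Cauchy (\<lambda>n. f (x n)))"

(* The normed space of finitely supported real sequences with the l1-norm is the
   library type nat \<Rightarrow>\<^sub>0 real: its norm is the sum of the absolute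
   values of the coordinates, as the next lemma records. *)
lemma norm_finsupp: "norm (a :: nat \<Rightarrow>\<^sub>0 real) =
    (\<Sum>i\<in>Poly_Mapping.keys a. \<bar>Poly_Mapping.lookup a i\<bar>)"
  by (simp add: norm_poly_mapping_def dist_poly_mapping_def)

definition ell1_map :: "(nat \<Rightarrow> 'a::real_vector) \<Rightarrow> (nat \<Rightarrow>\<^sub>0 real) \<Rightarrow> 'a" where
  "ell1_map x a = (\<Sum>i\<in>Poly_Mapping.keys a. Poly_Mapping.lookup a i *\<^sub>R x i)"

lemma lookup_scaleR: "Poly_Mapping.lookup (c *\<^sub>R a) i = c *\<^sub>R Poly_Mapping.lookup a i"
  for a :: "nat \<Rightarrow>\<^sub>0 real"
proof -
  have "finite {i. c *\<^sub>R Poly_Mapping.lookup a i \<noteq> 0}"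
    by (rule finite_subset[OF _ finite_keys[of a]]) (auto simp: in_keys_iff)
  then show ?thesis
    by (simp add: scaleR_poly_mapping_def)
qed

lemma ell1_map_superset:
  assumes "finite A" "Poly_Mapping.keys a \<subseteq> A"
  shows "ell1_map x a = (\<Sum>i\<in>A. Poly_Mapping.lookup a i *\<^sub>R x i)"
  unfolding ell1_map_def using assms
  by (intro sum.mono_neutral_left) (auto simp: in_keys_iff)

lemma linear_ell1_map: "linear (ell1_map x)"
proof (rule linearI)
  fix a b :: "nat \<Rightarrow>\<^sub>0 real" and c :: real
  let ?A = "Poly_Mapping.keys a \<union> Poly_Mapping.keys b"
  have "ell1_map x (a + b) = (\<Sum>i\<in>?A. Poly_Mapping.lookup (a + b) i *\<^sub>R x i)"
    by (rule ell1_map_superset) (simp_all add: Poly_Mapping.keys_add)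
  also have "\<dots> = (\<Sum>i\<in>?A. Poly_Mapping.lookup a i *\<^sub>R x i)
      + (\<Sum>i\<in>?A. Poly_Mapping.lookup b i *\<^sub>R x i)"
    by (simp add: lookup_add scaleR_add_left sum.distrib)
  also have "\<dots> = ell1_map x a + ell1_map x b"
    by (simp add: ell1_map_superset[of ?A])
  finally show "ell1_map x (a + b) = ell1_map x a + ell1_map x b" .
  have "ell1_map x (c *\<^sub>R a) = (\<Sum>i\<in>Poly_Mapping.keys a. Poly_Mapping.lookup (c *\<^sub>R a) i *\<^sub>R x i)"
    by (rule ell1_map_superset) (auto simp: in_keys_iff lookup_scaleR)
  then show "ell1_map x (c *\<^sub>R a) = c *\<^sub>R ell1_map x a"
    by (simp add: ell1_map_def lookup_scaleR scaleR_sum_right)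
qed

definition ell1_sequence :: "(nat \<Rightarrow> 'a::real_tvs) \<Rightarrow> bool" where
  "ell1_sequence x \<longleftrightarrow>
     linear (ell1_map x) \<and> (\<exists>g. homeomorphism UNIV (range (ell1_map x)) (ell1_map x) g)"

end

theory Submission
  imports Defs "HOL-Library.Diagonal_Subsequence"
begin

text \<open>
  Let \<open>V\<^sub>k\<close> be a countable base of neighbourhoods of 0 and let \<open>F\<^sub>k\<close> be the set of linear functionals
  bounded by 1 on \<open>V\<^sub>k\<close>. Fix \<open>k\<close> and rationals \<open>p < q\<close>. Rosenthal's combinatorial argument, applied to
  the sets \<open>{f \<in> F\<^sub>k. f (x\<^sub>n) > q}\<close> and \<open>{f \<in> F\<^sub>k. f (x\<^sub>n) < p}\<close>, yields a subsequence along which either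
  no \<open>f \<in> F\<^sub>k\<close> oscillates across \<open>[p, q]\<close> or the pairs are independent. Independence for a single
  triple \<open>(k, p, q)\<close> bounds the \<open>\<ell>\<^sub>1\<close>-norm of the coefficients by \<open>2 / (q - p)\<close> times the supremum over
  \<open>F\<^sub>k\<close>, so it gives an \<open>\<ell>\<^sub>1\<close>-sequence. Otherwise diagonalize over the countably many triples: every
  continuous functional lies in some \<open>F\<^sub>k\<close>, hence is Cauchy along the diagonal subsequence.
\<close>

section \<open>Rosenthal's dichotomy for pairs of sets\<close>

text \<open>\<open>E True n\<close> and \<open>E False n\<close> are the two members of Rosenthal's
  \<open>n\<close>-th pair; later the points are functionals, and the members say that the value at
  the \<open>n\<close>-th vector exceeds \<open>q\<close> or falls below \<open>p\<close>. A
  subsequence is encoded by its index set \<open>M\<close>.\<close>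

definition nonosc :: "(bool \<Rightarrow> nat \<Rightarrow> 'b set) \<Rightarrow> 'b set \<Rightarrow> nat set \<Rightarrow> bool" where
  "nonosc E C M \<longleftrightarrow> (\<forall>z\<in>C. \<exists>b. finite {n\<in>M. z \<in> E b n})"

text \<open>Quantifying over all infinite subsets makes the property survive every shrinking of
  \<open>M\<close>. It is vacuous for finite \<open>M\<close>, so infinitude is carried
  separately.\<close>

definition hereditarily_osc :: "(bool \<Rightarrow> nat \<Rightarrow> 'b set) \<Rightarrow> 'b set \<Rightarrow> nat set \<Rightarrow> bool" where
  "hereditarily_osc E C M \<longleftrightarrow> (\<forall>N\<subseteq>M. infinite N \<longrightarrow> \<not> nonosc E C N)"

text \<open>Finitely many extra indices keep a finite set finite. This serves diagonal sets, which
  lie in each earlier set only up to finitely many indices.\<close>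

lemma nonosc_almost_subset:
  assumes "nonosc E C M" "finite (N - M)"
  shows "nonosc E C N"
  unfolding nonosc_def
proof
  fix z assume "z \<in> C"
  then obtain b where b: "finite {n\<in>M. z \<in> E b n}"
    using assms(1) by (auto simp: nonosc_def)
  have "{n\<in>N. z \<in> E b n} \<subseteq> {n\<in>M. z \<in> E b n} \<union> (N - M)"
    by auto
  then show "\<exists>b. finite {n\<in>N. z \<in> E b n}"
    using b assms(2) by (meson finite_UnI finite_subset)
qed

lemma hereditarily_osc_subset:
  "hereditarily_osc E C M \<Longrightarrow> N \<subseteq> M \<Longrightarrow> hereditarily_osc E C N"
  unfolding hereditarily_osc_def by blast

text \<open>
  If every choice of \<open>j\<close> fails, iterate the failure along decreasing infinite sets and use the
  pigeonhole principle to fix \<open>C\<close> and \<open>b\<close>. On the resulting diagonal set no point of any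
  \<open>C \<inter> E b (j m)\<close> oscillates; a point of \<open>C\<close> outside all of these sets does not oscillate either.
\<close>
lemma hereditarily_osc_split:
  assumes "finite \<C>" "infinite M" and osc: "\<And>C. C \<in> \<C> \<Longrightarrow> hereditarily_osc E C M"
  shows "\<exists>j\<in>M. \<exists>N\<subseteq>M. infinite N \<and> (\<forall>C\<in>\<C>. \<forall>b. hereditarily_osc E (C \<inter> E b j) N)"
proof (rule ccontr)
  assume neg: "\<not> ?thesis"
  have fail: "\<exists>C\<in>\<C>. \<exists>b. \<exists>N'\<subseteq>N. infinite N' \<and> nonosc E (C \<inter> E b j) N'"
    if jN: "j \<in> M" "N \<subseteq> M" "infinite N" for j N
  proof -
    obtain C b where "C \<in> \<C>" "\<not> hereditarily_osc E (C \<inter> E b j) N"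
      using neg jN by blast
    then show ?thesis unfolding hereditarily_osc_def by meson
  qed
  \<comment> \<open>A state records the index \<open>j\<close>, the candidates \<open>N\<close>
    left, and the set \<open>C\<close> and side \<open>b\<close> at which the choice
    \<open>j\<close> fails. Placing \<open>N\<close> beyond \<open>j\<close> makes the chosen
    indices increase.\<close>
  define P where "P = (\<lambda>(j, N, C, b).
    j \<in> M \<and> N \<subseteq> M \<inter> {j<..} \<and> infinite N \<and> C \<in> \<C> \<and> nonosc E (C \<inter> E b j) N)"
  have next_state: "\<exists>t. P t \<and> fst t \<in> N \<and> fst (snd t) \<subseteq> N" if "N \<subseteq> M" "infinite N" for N
  proof -
    obtain j where j: "j \<in> N"
      using infinite_imp_nonempty[OF \<open>infinite N\<close>] by blast
    have "N - {..j} = N \<inter> {j<..}" by auto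
    then have "infinite (N \<inter> {j<..})"
      using \<open>infinite N\<close> by (metis Diff_infinite_finite finite_atMost)
    then obtain C b N' where "C \<in> \<C>" "N' \<subseteq> N \<inter> {j<..}" "infinite N'" "nonosc E (C \<inter> E b j) N'"
      using fail[of j "N \<inter> {j<..}"] j \<open>N \<subseteq> M\<close> by (meson inf.coboundedI1 subsetD)
    then have "P (j, N', C, b)" "j \<in> N" "N' \<subseteq> N"
      using j \<open>N \<subseteq> M\<close> by (auto simp: P_def)
    then show ?thesis by (metis fst_conv snd_conv)
  qed
  have "\<exists>f. \<forall>n. P (f n) \<and> (fst (f (Suc n)) \<in> fst (snd (f n)) \<and> fst (snd (f (Suc n))) \<subseteq> fst (snd (f n)))"
  proof (rule dependent_nat_choice)
    show "\<exists>t. P t" using next_state[of M] assms(2) by blast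
    show "\<exists>t'. P t' \<and> fst t' \<in> fst (snd t) \<and> fst (snd t') \<subseteq> fst (snd t)" if "P t" for t
      using that by (intro next_state) (auto simp: P_def)
  qed
  then obtain f where f: "\<And>n. P (f n)" "\<And>n. fst (f (Suc n)) \<in> fst (snd (f n))"
    "\<And>n. fst (snd (f (Suc n))) \<subseteq> fst (snd (f n))"
    by blast
  define j N where "j n = fst (f n)" and "N n = fst (snd (f n))" for n
  define col where "col n = snd (snd (f n))" for n
  have st: "j n \<in> M" "N n \<subseteq> M \<inter> {j n<..}" "fst (col n) \<in> \<C>"
    "nonosc E (fst (col n) \<inter> E (snd (col n)) (j n)) (N n)" for n
    using f(1)[of n] by (auto simp: P_def j_def N_def col_def split: prod.splits)
  have jN: "j (Suc n) \<in> N n" for n using f(2) by (simp add: j_def N_def)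
  have decN: "N n \<subseteq> N m" if "m \<le> n" for m n
    by (rule lift_Suc_antimono_le[OF _ that]) (use f(3) in \<open>simp add: N_def\<close>)
  have sm: "strict_mono j"
    using jN st(2) by (auto simp: strict_mono_Suc_iff)
  have "finite (range col)"
  proof (rule finite_subset)
    show "range col \<subseteq> \<C> \<times> UNIV" using st(3) by (simp add: image_subset_iff mem_Times_iff)
  qed (use assms(1) in simp)
  then obtain n0 where inf: "infinite {n \<in> UNIV. col n = col n0}"
    using pigeonhole_infinite[of UNIV col] by auto
  obtain C b where Cb: "col n0 = (C, b)" by (cases "col n0")
  define I where "I = {n. col n = (C, b)}"
  have I: "infinite I" using inf by (simp add: I_def Cb)
  have infM: "infinite (j ` I)"
    using I sm by (metis finite_imageD inj_on_subset strict_mono_imp_inj_on subset_UNIV)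
  have conv: "nonosc E (C \<inter> E b (j m)) (j ` I)" if "m \<in> I" for m
  proof (rule nonosc_almost_subset)
    show "nonosc E (C \<inter> E b (j m)) (N m)" using st(4)[of m] that by (simp add: I_def)
    \<comment> \<open>The index \<open>j n\<close> was drawn from \<open>N (n - 1)\<close>, which
      lies in \<open>N m\<close> once \<open>m < n\<close>; so only \<open>j 0, ..., j m\<close> can
      fall outside \<open>N m\<close>.\<close>
    have later: "j n \<in> N m" if "m < n" for n
    proof (cases n)
      case (Suc i)
      then have "N i \<subseteq> N m" using that by (intro decN) simp
      then show ?thesis using jN[of i] Suc by blast
    qed (use that in simp)
    have "j ` I - N m \<subseteq> j ` {..m}"
    proof
      fix y assume "y \<in> j ` I - N m"
      then obtain n where "y = j n" "j n \<notin> N m" by blast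
      then show "y \<in> j ` {..m}" using later[of n] not_le[of n m] by auto
    qed
    then show "finite (j ` I - N m)" by (rule finite_subset) simp
  qed
  have "nonosc E C (j ` I)"
    unfolding nonosc_def
  proof (intro ballI)
    fix z assume "z \<in> C"
    show "\<exists>b. finite {n \<in> j ` I. z \<in> E b n}"
    proof (cases "\<exists>m\<in>I. z \<in> E b (j m)")
      case True
      then obtain m where "m \<in> I" "z \<in> C \<inter> E b (j m)" using \<open>z \<in> C\<close> by auto
      then show ?thesis using conv[of m] by (simp only: nonosc_def)
    next
      case False
      then have "{n \<in> j ` I. z \<in> E b n} = {}" by auto
      then have "finite {n \<in> j ` I. z \<in> E b n}" by (simp only: finite.emptyI)
      then show ?thesis by (rule exI)
    qed
  qed
  moreover have "hereditarily_osc E C M" using osc st(3)[of n0] by (simp add: Cb)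
  moreover have "j ` I \<subseteq> M" using st(1) by auto
  ultimately show False using infM by (simp add: hereditarily_osc_def)
qed

text \<open>All atoms formed so far, that is, intersections of \<open>S\<close> with one side for
  each chosen index, are kept hereditarily oscillating at once;
  \<open>hereditarily_osc_split\<close> supplies the next index. On the empty set non-oscillation is
  trivial, so no atom is empty, and this is independence.\<close>

lemma hereditarily_osc_imp_independent:
  assumes "hereditarily_osc E S UNIV"
  shows "\<exists>r :: nat \<Rightarrow> nat. strict_mono r \<and> (\<forall>k \<epsilon>. \<exists>z\<in>S. \<forall>i<k. z \<in> E (\<epsilon> i) (r i))"
proof -
  define P where "P = (\<lambda>(j::nat, M, \<C>).
    infinite M \<and> M \<subseteq> {j<..} \<and> finite \<C> \<and> (\<forall>C\<in>\<C>. hereditarily_osc E C M))"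
  define Q where "Q = (\<lambda>(j::nat, M, \<C>) (j', M', \<C>').
    j' \<in> M \<and> M' \<subseteq> M \<and> \<C>' = (\<lambda>(C, b). C \<inter> E b j') ` (\<C> \<times> UNIV))"
  have "\<exists>f. \<forall>n::nat. (P (f n) \<and> (n = 0 \<longrightarrow> snd (snd (f n)) = {S})) \<and> Q (f n) (f (Suc n))"
  proof (rule dependent_nat_choice)
    have "P (0, {0<..}, {S})"
      using assms hereditarily_osc_subset[of E S UNIV "{0<..}"] by (auto simp: P_def infinite_Ioi)
    then show "\<exists>t. P t \<and> (0 = (0::nat) \<longrightarrow> snd (snd t) = {S})" by force
  next
    fix t and n :: nat
    assume "P t \<and> (n = 0 \<longrightarrow> snd (snd t) = {S})"
    then obtain j M \<C> where t: "t = (j, M, \<C>)" "infinite M" "M \<subseteq> {j<..}" "finite \<C>"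
      "\<And>C. C \<in> \<C> \<Longrightarrow> hereditarily_osc E C M"
      by (cases t) (auto simp: P_def)
    obtain j' N where j': "j' \<in> M" "N \<subseteq> M" "infinite N"
      "\<forall>C\<in>\<C>. \<forall>b. hereditarily_osc E (C \<inter> E b j') N"
      using hereditarily_osc_split[OF t(4,2,5)] by blast
    define M' where "M' = N \<inter> {j'<..}"
    have "N - {..j'} = M'" by (auto simp: M'_def)
    then have "infinite M'" using j'(3) by (metis Diff_infinite_finite finite_atMost)
    moreover have "\<forall>C\<in>\<C>. \<forall>b. hereditarily_osc E (C \<inter> E b j') M'"
      using j'(4) hereditarily_osc_subset M'_def by blast
    ultimately have "P (j', M', (\<lambda>(C, b). C \<inter> E b j') ` (\<C> \<times> UNIV))"
      using t(4) by (auto simp: P_def M'_def)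
    moreover have "Q t (j', M', (\<lambda>(C, b). C \<inter> E b j') ` (\<C> \<times> UNIV))"
      using j' by (auto simp: Q_def t(1) M'_def)
    ultimately show "\<exists>t'. (P t' \<and> (Suc n = 0 \<longrightarrow> snd (snd t') = {S})) \<and> Q t t'"
      by blast
  qed
  then obtain f where f: "\<And>n. P (f n)" "snd (snd (f 0)) = {S}" "\<And>n. Q (f n) (f (Suc n))"
    by blast
  \<comment> \<open>State 0 carries a dummy index, so the first genuine choice is read off state
    1.\<close>
  define r where "r n = fst (f (Suc n))" for n
  define \<D> where "\<D> n = snd (snd (f n))" for n
  have "r n < r (Suc n)" for n
    using f(1)[of "Suc n"] f(3)[of "Suc n"]
    by (auto simp: r_def P_def Q_def split: prod.splits)
  then have mono: "strict_mono r" by (simp add: strict_mono_Suc_iff)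
  have indep: "\<exists>z\<in>S. \<forall>i<k. z \<in> E (\<epsilon> i) (r i)" for k \<epsilon>
  proof -
    have "S \<inter> {z. \<forall>i<k. z \<in> E (\<epsilon> i) (r i)} \<in> \<D> k"
    proof (induction k)
      case 0
      then show ?case using f(2) by (simp add: \<D>_def)
    next
      case (Suc k)
      have "\<D> (Suc k) = (\<lambda>(C, b). C \<inter> E b (r k)) ` (\<D> k \<times> UNIV)"
        using f(3)[of k] by (auto simp: Q_def \<D>_def r_def split: prod.splits)
      moreover have "S \<inter> {z. \<forall>i<Suc k. z \<in> E (\<epsilon> i) (r i)}
          = (S \<inter> {z. \<forall>i<k. z \<in> E (\<epsilon> i) (r i)}) \<inter> E (\<epsilon> k) (r k)"
        by (auto simp: less_Suc_eq)
      ultimately show ?case using Suc by (metis (mono_tags, lifting) SigmaI UNIV_I case_prod_conv image_eqI)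
    qed
    moreover have "C \<noteq> {}" if "C \<in> \<D> k" for C
    proof -
      have "\<exists>M. infinite M \<and> hereditarily_osc E C M"
        using f(1)[of k] that by (auto simp: P_def \<D>_def split: prod.splits)
      then show ?thesis by (auto simp: hereditarily_osc_def nonosc_def)
    qed
    ultimately show ?thesis by blast
  qed
  show ?thesis by (intro exI[of _ r] conjI allI mono indep)
qed

text \<open>If hereditary oscillation fails, some infinite index set is non-oscillating. Its
  increasing enumeration is the subsequence, and injectivity carries finiteness back to
  positions.\<close>

lemma rosenthal_dichotomy:
  fixes E :: "bool \<Rightarrow> nat \<Rightarrow> 'b set"
  obtains (nonosc) r :: "nat \<Rightarrow> nat" where "strict_mono r"
      "\<And>z. z \<in> S \<Longrightarrow> \<exists>b. finite {n. z \<in> E b (r n)}"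
    | (independent) r :: "nat \<Rightarrow> nat" where "strict_mono r"
      "\<And>k \<epsilon>. \<exists>z\<in>S. \<forall>i<k. z \<in> E (\<epsilon> i) (r i)"
proof (cases "hereditarily_osc E S UNIV")
  case True
  then obtain r :: "nat \<Rightarrow> nat" where
    r: "strict_mono r" "\<forall>k \<epsilon>. \<exists>z\<in>S. \<forall>i<k. z \<in> E (\<epsilon> i) (r i)"
    using hereditarily_osc_imp_independent by blast
  show thesis by (rule independent[OF r(1) r(2)[rule_format]])
next
  case False
  then obtain N where N: "infinite N" "nonosc E S N"
    by (auto simp: hereditarily_osc_def)
  define r where "r = enumerate N"
  have r: "strict_mono r" "range r = N"
    using N(1) by (simp_all add: r_def strict_mono_enumerate range_enumerate)
  have "\<exists>b. finite {n. z \<in> E b (r n)}" if z: "z \<in> S" for z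
  proof -
    obtain b where b: "finite {n\<in>N. z \<in> E b n}" using N(2) z by (auto simp: nonosc_def)
    have "r ` {n. z \<in> E b (r n)} \<subseteq> {n\<in>N. z \<in> E b n}" using r(2) by auto
    then have "finite (r ` {n. z \<in> E b (r n)})" using b finite_subset by blast
    then show ?thesis
      using r(1) by (metis finite_imageD inj_on_subset strict_mono_imp_inj_on subset_UNIV)
  qed
  then show thesis by (rule nonosc[OF r(1)])
qed

section \<open>A Cauchy criterion for bounded real sequences\<close>

text \<open>A gap between liminf and limsup would contain a rational interval that the sequence
  crosses infinitely often. Rational endpoints keep the conditions countable, as the diagonal
  argument requires.\<close>

lemma bounded_nonosc_imp_Cauchy:
  fixes u :: "nat \<Rightarrow> real"
  assumes "bounded (range u)"
    and nonosc: "\<And>p q. p \<in> \<rat> \<Longrightarrow> q \<in> \<rat> \<Longrightarrow> p < q \<Longrightarrow> finite {n. u n > q} \<or> finite {n. u n < p}"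
  shows "Cauchy u"
proof -
  obtain B where B: "\<And>n. \<bar>u n\<bar> \<le> B"
    using assms(1) by (auto simp: bounded_iff)
  let ?U = "\<lambda>n. ereal (u n)"
  have "limsup ?U \<le> liminf ?U"
  proof (rule ccontr)
    assume "\<not> ?thesis"
    then have "liminf ?U < limsup ?U" by simp
    then obtain p where p: "liminf ?U < ereal p" "ereal p < limsup ?U" using ereal_dense2 by blast
    from ereal_dense2[OF p(2)] obtain q where "ereal p < ereal q" "ereal q < limsup ?U" by blast
    with p have pq: "liminf ?U < ereal p" "p < q" "ereal q < limsup ?U" by simp_all
    \<comment> \<open>\<open>p'\<close> and \<open>q'\<close> lie strictly inside the gap, so
      finiteness on one side pushes limsup below \<open>q\<close> or liminf above
      \<open>p\<close>.\<close>
    obtain p' where p': "p' \<in> \<rat>" "p < p'" "p' < q" using Rats_dense_in_real[OF pq(2)] by auto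
    obtain q' where q': "q' \<in> \<rat>" "p' < q'" "q' < q" using Rats_dense_in_real[OF p'(3)] by auto
    from nonosc[OF p'(1) q'(1,2)] show False
    proof
      assume "finite {n. u n > q'}"
      then have "eventually (\<lambda>n. ?U n \<le> ereal q') sequentially"
        by (simp add: cofinite_eq_sequentially[symmetric] eventually_cofinite not_le)
      then have "limsup ?U \<le> ereal q'" by (rule Limsup_bounded)
      with pq(3) have "ereal q < ereal q'" by (rule less_le_trans)
      with q'(3) show False by simp
    next
      assume "finite {n. u n < p'}"
      then have "eventually (\<lambda>n. ereal p' \<le> ?U n) sequentially"
        by (simp add: cofinite_eq_sequentially[symmetric] eventually_cofinite not_le)
      then have "ereal p' \<le> liminf ?U" by (rule Liminf_bounded)
      then have "ereal p' < ereal p" using pq(1) by (rule le_less_trans)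
      with p'(2) show False by simp
    qed
  qed
  then have eq: "limsup ?U = liminf ?U"
    by (simp add: Liminf_le_Limsup antisym)
  have "ereal (-B) \<le> liminf ?U" "limsup ?U \<le> ereal B"
    using B by (auto intro!: Liminf_bounded Limsup_bounded simp: abs_le_iff minus_le_iff)
  then have "\<bar>limsup ?U\<bar> \<noteq> \<infinity>" unfolding eq by auto
  then obtain l where l: "limsup ?U = ereal l" by blast
  have "?U \<longlonglongrightarrow> ereal l"
    by (rule Liminf_eq_Limsup[OF _ _ l]) (simp_all add: l eq[symmetric])
  then have "u \<longlonglongrightarrow> l" by simp
  then show ?thesis by (rule LIMSEQ_imp_Cauchy)
qed

section \<open>Topological vector spaces\<close>

lemma continuous_on_scaleR_tvs: "continuous_on UNIV (\<lambda>v::'a::real_tvs. c *\<^sub>R v)"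
proof -
  have "((\<lambda>v::'a. c *\<^sub>R v) \<longlongrightarrow> c *\<^sub>R w) (nhds w)" for w :: 'a
  proof -
    have "filterlim (\<lambda>v. (c, v)) (nhds c \<times>\<^sub>F nhds w) (nhds w)"
      by (intro filterlim_Pair tendsto_const filterlim_ident)
    from filterlim_compose[OF tendsto_scaleR_Pair this] show ?thesis by simp
  qed
  then show ?thesis
    by (auto simp: continuous_on_def intro: filterlim_mono[OF _ order_refl] at_within_le_nhds)
qed

lemma symmetric_convex_nbhd:
  fixes U :: "'a::real_lcs set"
  assumes "open U" "0 \<in> U"
  obtains V where "open V" "0 \<in> V" "convex V" "\<And>v. v \<in> V \<Longrightarrow> - v \<in> V" "V \<subseteq> U"
proof -
  obtain W where W: "open W" "0 \<in> W" "convex W" "W \<subseteq> U"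
    using locally_convex[OF assms] by blast
  let ?V = "W \<inter> uminus -` W"
  have "open (uminus -` W)"
    by (rule open_vimage[OF W(1)]) (intro continuous_intros)
  moreover have "convex (uminus -` W)"
    using W(3) by (intro convex_linear_vimage) (auto intro: linearI)
  ultimately show thesis
    using W by (intro that[of ?V]) (auto intro: convex_Int)
qed

text \<open>The sign of each \<open>c i\<close> moves into the vector, by symmetry, and the missing
  weight goes to the zero vector, indexed by \<open>None\<close> in the proof. The result is a
  convex combination.\<close>

lemma sum_scaleR_in_symmetric_convex:
  fixes x :: "nat \<Rightarrow> 'a::real_vector"
  assumes "convex V" "0 \<in> V" and sym: "\<And>v. v \<in> V \<Longrightarrow> - v \<in> V"
    and "finite I" "\<And>i. i \<in> I \<Longrightarrow> x i \<in> V" "(\<Sum>i\<in>I. \<bar>c i\<bar>) \<le> 1"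
  shows "(\<Sum>i\<in>I. c i *\<^sub>R x i) \<in> V"
proof -
  have "c i *\<^sub>R x i = \<bar>c i\<bar> *\<^sub>R (if c i \<ge> 0 then x i else - x i)" for i
    by auto
  then have "(\<Sum>i\<in>I. c i *\<^sub>R x i) = (\<Sum>i\<in>I. \<bar>c i\<bar> *\<^sub>R (if c i \<ge> 0 then x i else - x i))"
    by presburger
  also have "\<dots> = (\<Sum>i\<in>insert None (Some ` I).
      (case i of None \<Rightarrow> 1 - (\<Sum>i\<in>I. \<bar>c i\<bar>) | Some i \<Rightarrow> \<bar>c i\<bar>) *\<^sub>R
      (case i of None \<Rightarrow> 0 | Some i \<Rightarrow> if c i \<ge> 0 then x i else - x i))"
    using assms(4) by (subst sum.insert) (auto simp: sum.reindex)
  also have "\<dots> \<in> V"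
    by (rule convex_sum) (use assms in \<open>auto simp: sum.reindex sum.insert split: option.splits\<close>)
  finally show ?thesis .
qed

text \<open>Boundedness puts all \<open>(1 / t) *\<^sub>R x i\<close> into one symmetric convex
  \<open>V\<close> with a single \<open>t\<close>; coefficients of l1-norm below
  \<open>1 / t\<close> are then mapped into \<open>V\<close>.\<close>

lemma continuous_on_ell1_map:
  fixes x :: "nat \<Rightarrow> 'a::real_lcs"
  assumes "tvs_bounded (range x)"
  shows "continuous_on UNIV (ell1_map x)"
  unfolding continuous_on_topological
proof (intro ballI allI impI)
  fix a W assume W: "open W" "ell1_map x a \<in> W"
  let ?U = "(\<lambda>v. v + ell1_map x a) -` W"
  have "open ?U" by (rule open_vimage[OF W(1)]) (intro continuous_intros)
  then obtain V where V: "open V" "0 \<in> V" "convex V" "\<And>v. v \<in> V \<Longrightarrow> - v \<in> V" "V \<subseteq> ?U"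
    using symmetric_convex_nbhd[of ?U] W(2) by auto
  obtain s where s: "s > 0" "\<And>t. t > s \<Longrightarrow> range x \<subseteq> (\<lambda>u. t *\<^sub>R u) ` V"
    using assms V(1,2) unfolding tvs_bounded_def by blast
  \<comment> \<open>Absorption is given only for factors strictly above \<open>s\<close>.\<close>
  define t where "t = s + 1"
  have t: "t > 0" "t > s" using s(1) by (auto simp: t_def)
  have xV: "(1 / t) *\<^sub>R x i \<in> V" for i
  proof -
    obtain v where "v \<in> V" "x i = t *\<^sub>R v" using s(2)[OF t(2)] by blast
    then show ?thesis using t(1) by simp
  qed
  show "\<exists>A. open A \<and> a \<in> A \<and> (\<forall>b\<in>UNIV. b \<in> A \<longrightarrow> ell1_map x b \<in> W)"
  proof (intro exI conjI ballI impI)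
    show "open (ball a (1 / t))" "a \<in> ball a (1 / t)" using t(1) by auto
    fix b assume "b \<in> ball a (1 / t)"
    then have "norm (b - a) < 1 / t" by (simp add: dist_norm norm_minus_commute)
    then have "t * norm (b - a) \<le> 1" using t(1) by (simp add: field_simps)
    then have "(\<Sum>i\<in>Poly_Mapping.keys (b - a). \<bar>t * Poly_Mapping.lookup (b - a) i\<bar>) \<le> 1"
      using t(1) by (simp add: norm_finsupp abs_mult sum_distrib_left)
    then have "(\<Sum>i\<in>Poly_Mapping.keys (b - a). (t * Poly_Mapping.lookup (b - a) i) *\<^sub>R ((1 / t) *\<^sub>R x i)) \<in> V"
      by (intro sum_scaleR_in_symmetric_convex V xV) auto
    then have "ell1_map x (b - a) \<in> V" using t(1) by (simp add: ell1_map_def)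
    then show "ell1_map x b \<in> W"
      using V(5) by (auto simp: linear_diff[OF linear_ell1_map])
  qed
qed

section \<open>Lower estimates and continuity of the inverse map\<close>

text \<open>Independence concerns initial segments, so the support is padded to one.\<close>

lemma ell1_map_eq_sum_lessThan:
  obtains k where "ell1_map x a = (\<Sum>i<k. Poly_Mapping.lookup a i *\<^sub>R x i)" "norm a = (\<Sum>i<k. \<bar>Poly_Mapping.lookup a i\<bar>)"
proof -
  obtain k where k: "Poly_Mapping.keys a \<subseteq> {..<k}"
    using finite_keys[of a] unfolding finite_nat_iff_bounded by blast
  have "norm a = (\<Sum>i<k. \<bar>Poly_Mapping.lookup a i\<bar>)"
    unfolding norm_finsupp using k by (intro sum.mono_neutral_left) (auto simp: in_keys_iff)
  then show thesis using that ell1_map_superset[OF _ k] by blast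
qed

text \<open>One functional does not suffice, since \<open>p\<close> and \<open>q\<close> may have
  the same sign. With \<open>f\<close> and \<open>g\<close> of opposite sign patterns, each
  coordinate contributes at least \<open>q - p\<close> times its modulus to the difference of their
  values, so one of the two values has at least half the total as modulus.\<close>

lemma independent_lower_bound:
  fixes x :: "nat \<Rightarrow> 'a::real_vector" and p q :: real
  assumes F: "\<And>f. f \<in> F \<Longrightarrow> linear f"
    and indep: "\<And>k (\<epsilon> :: nat \<Rightarrow> bool). \<exists>f\<in>F. \<forall>i<k. if \<epsilon> i then f (x i) > q else f (x i) < p"
  shows "\<exists>f\<in>F. (q - p) / 2 * norm a \<le> \<bar>f (ell1_map x a)\<bar>"
proof -
  obtain k where k: "ell1_map x a = (\<Sum>i<k. Poly_Mapping.lookup a i *\<^sub>R x i)" "norm a = (\<Sum>i<k. \<bar>Poly_Mapping.lookup a i\<bar>)"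
    by (rule ell1_map_eq_sum_lessThan)
  obtain f where f: "f \<in> F" "\<forall>i<k. if Poly_Mapping.lookup a i \<ge> 0 then f (x i) > q else f (x i) < p"
    using indep[of k "\<lambda>i. Poly_Mapping.lookup a i \<ge> 0"] by blast
  obtain g where g: "g \<in> F" "\<forall>i<k. if \<not> Poly_Mapping.lookup a i \<ge> 0 then g (x i) > q else g (x i) < p"
    using indep[of k "\<lambda>i. \<not> Poly_Mapping.lookup a i \<ge> 0"] by blast
  have expand: "h (ell1_map x a) = (\<Sum>i<k. Poly_Mapping.lookup a i * h (x i))" if "h \<in> F" for h
    by (simp add: k(1) linear_sum[OF F[OF that]] linear_scale[OF F[OF that]])
  have "(q - p) * norm a = (\<Sum>i<k. (q - p) * \<bar>Poly_Mapping.lookup a i\<bar>)"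
    by (simp add: k(2) sum_distrib_left)
  also have "\<dots> \<le> (\<Sum>i<k. Poly_Mapping.lookup a i * (f (x i) - g (x i)))"
  proof (rule sum_mono)
    fix i assume "i \<in> {..<k}"
    then have i: "i < k" by simp
    show "(q - p) * \<bar>Poly_Mapping.lookup a i\<bar> \<le> Poly_Mapping.lookup a i * (f (x i) - g (x i))"
    proof (cases "Poly_Mapping.lookup a i \<ge> 0")
      case True
      then have "q - p \<le> f (x i) - g (x i)" using f(2) g(2) i by fastforce
      from mult_left_mono[OF this True] show ?thesis using True by (simp add: mult.commute)
    next
      case False
      then have "q - p \<le> g (x i) - f (x i)" using f(2) g(2) i by fastforce
      from mult_left_mono[OF this, of "- Poly_Mapping.lookup a i"] show ?thesis
        using False by (simp add: algebra_simps)
    qed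
  qed
  also have "\<dots> = f (ell1_map x a) - g (ell1_map x a)"
    by (simp add: expand f(1) g(1) right_diff_distrib sum_subtractf)
  finally have "(q - p) / 2 * norm a \<le> \<bar>f (ell1_map x a)\<bar> \<or> (q - p) / 2 * norm a \<le> \<bar>g (ell1_map x a)\<bar>"
    by (auto simp: abs_if split: if_splits)
  then show ?thesis using f(1) g(1) by blast
qed

text \<open>A functional bounded by 1 on \<open>V\<close> is bounded by \<open>e\<close> on the
  multiple of \<open>V\<close> by \<open>e\<close>, so images in small multiples of \<open>V\<close>
  come only from coefficients of small norm. This gives injectivity and continuity of the inverse;
  \<open>bdd\<close> gives continuity of the map itself.\<close>

lemma ell1_sequenceI:
  fixes x :: "nat \<Rightarrow> 'a::real_lcs"
  assumes bdd: "tvs_bounded (range x)"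
    and V: "open V" "0 \<in> V" and "\<delta> > 0"
    and lower: "\<And>a. \<exists>f. linear f \<and> (\<forall>v\<in>V. \<bar>f v\<bar> \<le> 1) \<and> \<delta> * norm a \<le> \<bar>f (ell1_map x a)\<bar>"
  shows "ell1_sequence x"
proof -
  let ?T = "ell1_map x"
  have small: "\<delta> * norm a \<le> e" if "(1 / e) *\<^sub>R ?T a \<in> V" "e > 0" for a e
  proof -
    obtain f where f: "linear f" "\<forall>v\<in>V. \<bar>f v\<bar> \<le> 1" "\<delta> * norm a \<le> \<bar>f (?T a)\<bar>"
      using lower by blast
    have "\<bar>f ((1 / e) *\<^sub>R ?T a)\<bar> \<le> 1" using f(2) that(1) by blast
    then have "\<bar>f (?T a)\<bar> \<le> e" using that(2) by (simp add: linear_scale[OF f(1)] field_simps)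
    then show ?thesis using f(3) by simp
  qed
  have "inj ?T"
  proof (rule linear_injective_0[OF linear_ell1_map, THEN iffD2], intro allI impI)
    fix a assume "?T a = 0"
    then have "\<delta> * norm a \<le> e" if "e > 0" for e using small that V(2) by simp
    then have "\<delta> * norm a \<le> 0" by (rule field_le_epsilon[of _ 0, simplified])
    then show "a = 0" using \<open>\<delta> > 0\<close> by (simp add: mult_le_0_iff)
  qed
  have "continuous_on (range ?T) (inv ?T)"
    unfolding continuous_on_def
  proof (intro ballI)
    fix y assume "y \<in> range ?T"
    then obtain a where a: "y = ?T a" by blast
    have "eventually (\<lambda>z. dist (inv ?T z) a < e) (at y within range ?T)" if "e > 0" for e
    proof -
      \<comment> \<open>\<open>small\<close> yields a weak inequality; the factor 1/2 makes the
        final bound strict.\<close>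
      define d where "d = \<delta> * e / 2"
      have d: "d > 0" using \<open>\<delta> > 0\<close> that by (simp add: d_def)
      let ?W = "(\<lambda>z. (1 / d) *\<^sub>R (z - y)) -` V"
      have "open ?W"
        by (rule open_vimage[OF V(1)])
          (rule continuous_on_compose2[OF continuous_on_scaleR_tvs], auto intro!: continuous_intros)
      moreover have "y \<in> ?W" using V(2) by simp
      moreover have "dist (inv ?T z) a < e" if z: "z \<in> ?W" "z \<in> range ?T" for z
      proof -
        obtain b where b: "z = ?T b" using z(2) by blast
        have "\<delta> * norm (b - a) \<le> d"
          using z(1) by (intro small[OF _ d]) (simp add: linear_diff[OF linear_ell1_map] a b)
        also have "d < \<delta> * e" using \<open>\<delta> > 0\<close> \<open>e > 0\<close> by (simp add: d_def)
        finally show ?thesis using \<open>\<delta> > 0\<close> \<open>inj ?T\<close> by (simp add: b dist_norm)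
      qed
      ultimately show ?thesis unfolding eventually_at_topological by blast
    qed
    then show "(inv ?T \<longlongrightarrow> inv ?T y) (at y within range ?T)"
      using \<open>inj ?T\<close> by (simp add: a tendsto_iff)
  qed
  moreover have "inv ?T ` range ?T = UNIV"
    using \<open>inj ?T\<close> by (simp add: image_comp)
  ultimately have "homeomorphism UNIV (range ?T) ?T (inv ?T)"
    using \<open>inj ?T\<close> continuous_on_ell1_map[OF bdd]
    by (auto simp: homeomorphism_def f_inv_into_f)
  then show ?thesis unfolding ell1_sequence_def using linear_ell1_map by blast
qed

lemma continuous_linear_bounded_range:
  fixes x :: "nat \<Rightarrow> 'a::real_tvs" and f :: "'a \<Rightarrow> real"
  assumes "tvs_bounded (range x)" "linear f" "open V" "0 \<in> V" "\<And>v. v \<in> V \<Longrightarrow> \<bar>f v\<bar> \<le> 1"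
  shows "bounded (range (\<lambda>n. f (x n)))"
proof -
  obtain s where s: "s > 0" "\<And>t. t > s \<Longrightarrow> range x \<subseteq> (\<lambda>u. t *\<^sub>R u) ` V"
    using assms(1,3,4) unfolding tvs_bounded_def by blast
  have "\<bar>f (x n)\<bar> \<le> s + 1" for n
  proof -
    obtain v where v: "v \<in> V" "x n = (s + 1) *\<^sub>R v" using s(2)[of "s + 1"] by auto
    then have "\<bar>f (x n)\<bar> = (s + 1) * \<bar>f v\<bar>"
      using s(1) by (simp add: linear_scale[OF assms(2)] abs_mult)
    also have "\<dots> \<le> s + 1" using assms(5)[OF v(1)] s(1) by (simp add: mult_left_le)
    finally show ?thesis .
  qed
  then show ?thesis by (auto simp: bounded_iff)
qed

text \<open>Metrizability enters through first countability. Basis sets missing \<open>z\<close> are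
  discarded before the enumeration; the neighbourhood \<open>UNIV\<close> shows that some set
  remains.\<close>

lemma metrizable_countable_nbhd_base:
  fixes z :: "'a::topological_space"
  assumes "metrizable_space (euclidean :: 'a topology)"
  obtains V :: "nat \<Rightarrow> 'a set" where "\<And>k. open (V k)" "\<And>k. z \<in> V k"
    "\<And>U. open U \<Longrightarrow> z \<in> U \<Longrightarrow> \<exists>k. V k \<subseteq> U"
proof -
  have "first_countable (euclidean :: 'a topology)"
    using assms by (rule metrizable_imp_first_countable)
  then have "\<exists>\<B>. countable \<B> \<and> (\<forall>B\<in>\<B>. open B) \<and> (\<forall>U. open U \<and> z \<in> U \<longrightarrow> (\<exists>B\<in>\<B>. z \<in> B \<and> B \<subseteq> U))"
    unfolding first_countable_def by (simp add: open_openin[symmetric])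
  then obtain \<B> where \<B>: "countable \<B>" "\<And>B. B \<in> \<B> \<Longrightarrow> open B"
    "\<And>U. open U \<Longrightarrow> z \<in> U \<Longrightarrow> \<exists>B\<in>\<B>. z \<in> B \<and> B \<subseteq> U"
    by metis
  let ?\<B> = "{B \<in> \<B>. z \<in> B}"
  have "?\<B> \<noteq> {}" "countable ?\<B>" using \<B>(1) \<B>(3)[of UNIV] by auto
  then have range: "range (from_nat_into ?\<B>) = ?\<B>" by (rule range_from_nat_into)
  then have "from_nat_into ?\<B> k \<in> ?\<B>" for k by blast
  moreover have "\<exists>k. from_nat_into ?\<B> k \<subseteq> U" if U: "open U" "z \<in> U" for U
  proof -
    obtain B where "B \<in> range (from_nat_into ?\<B>)" "B \<subseteq> U" using \<B>(3)[OF U] range by auto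
    then show ?thesis by auto
  qed
  ultimately show thesis using \<B>(2) by (intro that[of "from_nat_into ?\<B>"]) auto
qed

lemma tvs_bounded_subset: "tvs_bounded S \<Longrightarrow> T \<subseteq> S \<Longrightarrow> tvs_bounded T"
  unfolding tvs_bounded_def by (meson order_trans)

section \<open>Diagonalization over neighbourhoods and rational intervals\<close>

theorem theorem3p5:
  fixes x :: "nat \<Rightarrow> 'a::real_lcs"
  assumes "metrizable_space (euclidean :: 'a topology)"
    and "tvs_bounded (range x)"
  shows "\<exists>r :: nat \<Rightarrow> nat. strict_mono r \<and> (weakly_Cauchy (x \<circ> r) \<or> ell1_sequence (x \<circ> r))"
proof -
  obtain V :: "nat \<Rightarrow> 'a set" where V: "\<And>k. open (V k)" "\<And>k. 0 \<in> V k"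
    "\<And>U. open U \<Longrightarrow> 0 \<in> U \<Longrightarrow> \<exists>k. V k \<subseteq> U"
    using metrizable_countable_nbhd_base[OF assms(1), of 0] by metis
  \<comment> \<open>\<open>F k\<close> is the polar of \<open>V k\<close>; boundedness on this
    neighbourhood of 0 encodes continuity.\<close>
  define F where "F k = {f :: 'a \<Rightarrow> real. linear f \<and> (\<forall>v\<in>V k. \<bar>f v\<bar> \<le> 1)}" for k
  define nonosc_at where "nonosc_at = (\<lambda>(k, p, q) (s :: nat \<Rightarrow> nat). \<forall>f\<in>F k.
    finite {n. f (x (s n)) > real_of_rat q} \<or> finite {n. f (x (s n)) < real_of_rat p})"
  \<comment> \<open>The assumption \<open>fin\<close> covers two situations: \<open>s'\<close> is a
    subsequence of \<open>s\<close>, or \<open>s\<close> is a tail of \<open>s'\<close>.\<close>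
  have transfer: "nonosc_at t s'"
    if "nonosc_at t s" and fin: "\<And>Q. finite {n. Q (s n)} \<Longrightarrow> finite {n. Q (s' n)}" for t s s'
  proof -
    obtain k p q where t: "t = (k, p, q)" by (rule prod_cases3)
    have "finite {n. f (x (s' n)) > real_of_rat q} \<or> finite {n. f (x (s' n)) < real_of_rat p}"
      if "f \<in> F k" for f
      using \<open>nonosc_at t s\<close> that fin[of "\<lambda>n. f (x n) > real_of_rat q"]
        fin[of "\<lambda>n. f (x n) < real_of_rat p"]
      by (auto simp: t nonosc_at_def)
    then show ?thesis by (simp add: t nonosc_at_def)
  qed
  have bdd: "tvs_bounded (range (x \<circ> s))" for s :: "nat \<Rightarrow> nat"
    using assms(2) by (rule tvs_bounded_subset) auto
  show ?thesis
  proof (cases "\<exists>r. strict_mono r \<and> ell1_sequence (x \<circ> r)")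
    case True
    then show ?thesis by blast
  next
    case False
    have refine: "\<exists>r :: nat \<Rightarrow> nat. strict_mono r \<and> nonosc_at (k, p, q) (s \<circ> r)"
      if s: "strict_mono s" and "p < q" for s :: "nat \<Rightarrow> nat" and k p q
    proof (cases rule: rosenthal_dichotomy[of "F k"
          "\<lambda>b n. {f. if b then f (x (s n)) > real_of_rat q else f (x (s n)) < real_of_rat p}"])
      case (nonosc r)
      then show ?thesis
        by (intro exI[of _ r]) (auto simp: nonosc_at_def ex_bool_eq)
    next
      \<comment> \<open>This alternative is excluded: it would produce an l1-sequence, against the
        case assumption \<open>False\<close>.\<close>
      case (independent r)
      have "ell1_sequence (x \<circ> (s \<circ> r))"
      proof (rule ell1_sequenceI[OF bdd V(1,2)])
        show "(real_of_rat q - real_of_rat p) / 2 > 0" using \<open>p < q\<close> by (simp add: of_rat_less)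
        show "\<exists>f. linear f \<and> (\<forall>v\<in>V k. \<bar>f v\<bar> \<le> 1) \<and>
            (real_of_rat q - real_of_rat p) / 2 * norm a \<le> \<bar>f (ell1_map (x \<circ> (s \<circ> r)) a)\<bar>" for a
        proof -
          have "\<exists>f\<in>F k. (real_of_rat q - real_of_rat p) / 2 * norm a \<le> \<bar>f (ell1_map (x \<circ> (s \<circ> r)) a)\<bar>"
          proof (rule independent_lower_bound)
            show "linear f" if "f \<in> F k" for f using that by (simp add: F_def)
            show "\<exists>f\<in>F k. \<forall>i<l. if \<epsilon> i then f ((x \<circ> (s \<circ> r)) i) > real_of_rat q
                else f ((x \<circ> (s \<circ> r)) i) < real_of_rat p" for l and \<epsilon> :: "nat \<Rightarrow> bool"
              using independent(2)[of l \<epsilon>] by (simp only: comp_apply mem_Collect_eq)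
          qed
          then show ?thesis by (simp add: F_def conj_assoc Bex_def)
        qed
      qed
      then show ?thesis using False strict_mono_o[OF s independent(1)] by blast
    qed
    \<comment> \<open>Stage \<open>n\<close> treats the triple coded by \<open>n\<close>. Codes with
      \<open>p \<ge> q\<close> impose nothing, so every stage can be carried out.\<close>
    define P where "P n s \<longleftrightarrow> (case from_nat n of (k, p, q) \<Rightarrow> p < q \<longrightarrow> nonosc_at (k, p, q) s)" for n s
    interpret subseqs P
    proof
      fix n and s :: "nat \<Rightarrow> nat" assume "strict_mono s"
      then show "\<exists>r'. strict_mono r' \<and> P n (s \<circ> r')"
      proof (cases "from_nat n :: nat \<times> rat \<times> rat")
        case (fields k p q)
        show ?thesis
        proof (cases "p < q")
          case True
          then show ?thesis using refine[OF \<open>strict_mono s\<close> True, of k] fields by (simp add: P_def)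
        next
          case False
          then show ?thesis using strict_mono_id fields by (auto simp: P_def)
        qed
      qed
    qed
    define d where "d = diagseq"
    have d: "strict_mono d" unfolding d_def by (rule subseq_diagseq)
    have nonosc_d: "nonosc_at (k, p, q) d" if "p < q" for k p q
    proof -
      define m where "m = to_nat (k, p, q)"
      \<comment> \<open>The diagonal is a subsequence of the one chosen for \<open>m\<close> only
        from position \<open>Suc m\<close> on; \<open>fin\<close> below puts the finitely many
        earlier terms back.\<close>
      have "P m (d \<circ> (+) (Suc m))"
        unfolding d_def
      proof (rule diagseq_holds)
        fix n s r assume r: "strict_mono (r :: nat \<Rightarrow> nat)" and "P n s"
        have fin: "finite {i. Q (s (r i))}" if "finite {i. Q (s i)}" for Q
          using finite_vimageI[OF that strict_mono_imp_inj_on[OF r]] by (simp add: vimage_def)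
        then show "P n (s \<circ> r)"
          using \<open>P n s\<close> transfer[of _ s "s \<circ> r"] by (auto simp: P_def split: prod.splits)
      qed
      then have tail: "nonosc_at (k, p, q) (d \<circ> (+) (Suc m))"
        using that by (simp add: P_def m_def)
      have fin: "finite {i. Q (d i)}" if "finite {i. Q (d (Suc m + i))}" for Q
      proof (rule finite_subset)
        show "{i. Q (d i)} \<subseteq> {..m} \<union> (+) (Suc m) ` {i. Q (d (Suc m + i))}"
        proof
          fix i assume "i \<in> {i. Q (d i)}"
          then show "i \<in> {..m} \<union> (+) (Suc m) ` {i. Q (d (Suc m + i))}"
            by (cases "i \<le> m") (auto intro!: image_eqI[of _ _ "i - Suc m"])
        qed
      qed (use that in simp)
      show ?thesis by (rule transfer[OF tail]) (rule fin, simp)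
    qed
    have "weakly_Cauchy (x \<circ> d)"
      unfolding weakly_Cauchy_def
    proof (intro allI impI)
      fix f :: "'a \<Rightarrow> real" assume f: "linear f \<and> continuous_on UNIV f"
      have "open (f -` ball 0 1)" using f by (intro open_vimage) auto
      moreover have "0 \<in> f -` ball 0 1" using linear_0[of f] f by simp
      ultimately obtain k where k: "V k \<subseteq> f -` ball 0 1" using V(3) by blast
      then have "\<bar>f v\<bar> \<le> 1" if "v \<in> V k" for v using that by (fastforce simp: dist_real_def)
      then have k: "f \<in> F k" using f by (simp add: F_def)
      show "Cauchy (\<lambda>n. f ((x \<circ> d) n))"
      proof (rule bounded_nonosc_imp_Cauchy)
        show "bounded (range (\<lambda>n. f ((x \<circ> d) n)))"
          using k by (intro continuous_linear_bounded_range[OF bdd _ V(1,2)]) (auto simp: F_def)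
        fix p q :: real assume "p \<in> \<rat>" "q \<in> \<rat>" "p < q"
        then obtain p' q' where "p = real_of_rat p'" "q = real_of_rat q'" "p' < q'"
          by (metis Rats_cases of_rat_less)
        then show "finite {n. f ((x \<circ> d) n) > q} \<or> finite {n. f ((x \<circ> d) n) < p}"
          using nonosc_d[of p' q' k] k by (auto simp: nonosc_at_def)
      qed
    qed
    then show ?thesis using d by blast
  qed
qed

end
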